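(* Consider an $n$-qudit state $|\Psi\rangle=\sum_{1\le i_1,\ldots,i_n\le d}c_{i_1i_2\cdots i_n}|i_1\rangle\otimes|i_2\rangle\otimes\cdots\otimes|i_n\rangle$ of norm one, where $\{|1\rangle,|2\rangle,\ldots,|d\rangle\}$ is an orthonormal basis of a $d$-dimensional complex inner product space. For $a=1,\ldots,n$ let $\lambda_i^{(a)}$, $i=1,2,\ldots,d$, be the eigenvalues (with multiplicity) of the $a$th reduced density matrix, ordered so that $\lambda_i^{(a)}\le\lambda_j^{(a)}$ if $i<j$. Then $$\sum_{a=1}^{n-1}\sum_{i=1}^{d-1}\lambda_i^{(a)}\ \ge\ \lambda_1^{(n)}+\lambda_2^{(n)}+\cdots+\lambda_{d-1}^{(n)}.$$
   Context: The $a$th (one-particle) reduced density matrix of $|\Psi\rangle$ is the $d\times d$ matrix $\rho^{(a)}$ with entries $\rho^{(a)}_{ii'}=\sum c_{i_1\cdots i_{a-1}\,i\,i_{a+1}\cdots i_n}\,\overline{c_{i_1\cdots i_{a-1}\,i'\,i_{a+1}\cdots i_n}}$, the sum being over all $i_1,\ldots,i_{a-1},i_{a+1},\ldots,i_n\in\{1,\ldots,d\}$. *)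

theory Defs
  imports "HOL-Library.FuncSet" "Jordan_Normal_Form.Char_Poly"
begin

text \<open>
  An \<open>n\<close>-qudit state is given by its amplitudes \<open>c\<close> in the product basis: a multi-index
  \<open>(i\<^sub>1, \<dots>, i\<^sub>n)\<close> is an extensional function on \<open>{1..n}\<close> with values in \<open>{1..d}\<close>, and only the
  values of \<open>c\<close> on such functions matter. The product vectors of an orthonormal basis form
  an orthonormal basis of the tensor product, so the norm of the state is the
  \<open>\<ell>\<^sup>2\<close>-norm of its amplitudes.
\<close>

definition multi_index :: "nat \<Rightarrow> nat set \<Rightarrow> (nat \<Rightarrow> nat) set" where
  "multi_index d A = A \<rightarrow>\<^sub>E {1..d}"

definition state_norm :: "nat \<Rightarrow> nat \<Rightarrow> ((nat \<Rightarrow> nat) \<Rightarrow> complex) \<Rightarrow> real" where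
  "state_norm n d c = sqrt (\<Sum>f\<in>multi_index d {1..n}. (cmod (c f))\<^sup>2)"

text \<open>
  In the next definition \<open>f(a := i)\<close> inserts \<open>i\<close> at position \<open>a\<close> into a multi-index \<open>f\<close> of the
  other positions. Matrix indices start at \<open>0\<close>, hence the shift by \<open>Suc\<close>.
\<close>

definition reduced_density :: "nat \<Rightarrow> nat \<Rightarrow> ((nat \<Rightarrow> nat) \<Rightarrow> complex) \<Rightarrow> nat \<Rightarrow> complex mat" where
  "reduced_density n d c a = mat d d (\<lambda>(i, i').
     \<Sum>f\<in>multi_index d ({1..n} - {a}). c (f(a := Suc i)) * cnj (c (f(a := Suc i'))))"

text \<open>
  \<open>lam 1 \<le> \<dots> \<le> lam d\<close> are the eigenvalues of \<open>A\<close>, counted with multiplicity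
  as roots of the characteristic polynomial.
\<close>

definition ordered_eigenvalues :: "nat \<Rightarrow> complex mat \<Rightarrow> (nat \<Rightarrow> real) \<Rightarrow> bool" where
  "ordered_eigenvalues d A lam \<longleftrightarrow>
     proots (char_poly A) = image_mset (\<lambda>i. complex_of_real (lam i)) (mset_set {1..d}) \<and>
     (\<forall>i\<in>{1..d}. \<forall>j\<in>{1..d}. i < j \<longrightarrow> lam i \<le> lam j)"

text \<open>
  Reduced density matrices are Hermitian, so such an enumeration by real numbers always exists.
\<close>

lemma reduced_density_eigenvalue_real:
  assumes "eigenvalue (reduced_density n d c a) k"
  shows "k \<in> \<real>"
proof -
  let ?A = "reduced_density n d c a"
  have A: "?A \<in> carrier_mat d d" by (simp add: reduced_density_def)
  have herm: "?A $$ (j, i) = cnj (?A $$ (i, j))" if "i < d" "j < d" for i j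
    using that by (simp add: reduced_density_def mult.commute)
  obtain v where v: "v \<in> carrier_vec d" "v \<noteq> 0\<^sub>v d" "?A *\<^sub>v v = k \<cdot>\<^sub>v v"
    using assms A unfolding eigenvalue_def eigenvector_def by auto
  have Av: "(\<Sum>j<d. ?A $$ (i, j) * v $ j) = k * v $ i" if "i < d" for i
  proof -
    have "(?A *\<^sub>v v) $ i = (\<Sum>j<d. ?A $$ (i, j) * v $ j)"
      using that A v(1) by (simp add: scalar_prod_def lessThan_atLeast0)
    with v that show ?thesis by auto
  qed
  define S where "S = (\<Sum>i<d. \<Sum>j<d. cnj (v $ i) * (?A $$ (i, j) * v $ j))"
  define N where "N = (\<Sum>i<d. (cmod (v $ i))\<^sup>2)"
  have S: "S = k * complex_of_real N"
  proof -
    have "S = (\<Sum>i<d. cnj (v $ i) * (k * v $ i))"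
      unfolding S_def using Av by (simp flip: sum_distrib_left)
    also have "\<dots> = k * complex_of_real N"
      unfolding N_def of_real_sum sum_distrib_left
      by (intro sum.cong) (simp_all add: complex_norm_square ac_simps flip: of_real_power)
    finally show ?thesis .
  qed
  have "cnj S = (\<Sum>i<d. \<Sum>j<d. v $ i * (?A $$ (j, i) * cnj (v $ j)))"
    unfolding S_def cnj_sum by (intro sum.cong) (simp_all add: herm[symmetric])
  also have "\<dots> = S"
    unfolding S_def by (subst sum.swap, intro sum.cong) (simp_all only: ac_simps)
  finally have "cnj k * complex_of_real N = k * complex_of_real N"
    using S by simp
  moreover have "N \<noteq> 0"
  proof
    assume "N = 0"
    then have "\<forall>i<d. v $ i = 0"
      unfolding N_def by (subst (asm) sum_nonneg_eq_0_iff) auto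
    with v(1) have "v = 0\<^sub>v d" by (intro eq_vecI) auto
    with v(2) show False by simp
  qed
  ultimately show ?thesis by (simp add: Reals_cnj_iff)
qed

lemma ex_ordered_eigenvalues: "\<exists>lam. ordered_eigenvalues d (reduced_density n d c a) lam"
proof -
  let ?A = "reduced_density n d c a"
  have A: "?A \<in> carrier_mat d d" by (simp add: reduced_density_def)
  obtain es where es: "char_poly ?A = (\<Prod>a\<leftarrow>es. [:- a, 1:])" "length es = d"
    using char_poly_factorized[OF A] by blast
  have real: "complex_of_real (Re z) = z" if "z \<in> set es" for z
  proof -
    have "eigenvalue ?A z"
      using that es unfolding eigenvalue_root_char_poly[OF A]
      by (auto simp: poly_prod_list prod_list_zero_iff)
    then show ?thesis by (simp add: reduced_density_eigenvalue_real)
  qed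
  define xs where "xs = sort (map Re es)"
  have len: "length xs = d" using es by (simp add: xs_def)
  define lam where "lam i = xs ! (i - 1)" for i
  have roots: "proots (\<Prod>a\<leftarrow>bs. [:- a, 1:]) = mset bs" for bs :: "complex list"
  proof (induction bs)
    case (Cons b bs)
    have "(\<Prod>a\<leftarrow>bs. [:- a, 1:]) \<noteq> 0" by (auto simp: prod_list_zero_iff)
    then have "proots ([:- b, 1:] * (\<Prod>a\<leftarrow>bs. [:- a, 1:])) = {#b#} + mset bs"
      by (subst proots_mult) (use Cons in \<open>auto simp: proots_linear_factor\<close>)
    then show ?case by simp
  qed simp
  have "mset xs = image_mset lam (mset [1..<Suc d])"
    unfolding mset_map[symmetric]
    by (rule arg_cong[where f = mset], rule nth_equalityI) (auto simp: len lam_def simp del: upt_Suc)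
  moreover have "mset [1..<Suc d] = mset_set {1..d}"
    by (metis atLeastLessThanSuc_atLeastAtMost mset_upt)
  ultimately have "image_mset lam (mset_set {1..d}) = image_mset Re (mset es)"
    by (simp add: xs_def)
  then have "image_mset complex_of_real (image_mset lam (mset_set {1..d}))
      = image_mset complex_of_real (image_mset Re (mset es))" by simp
  also have "\<dots> = image_mset (\<lambda>z. z) (mset es)"
    unfolding multiset.map_comp by (rule image_mset_cong) (simp add: real)
  finally have "proots (char_poly ?A) = image_mset (\<lambda>i. complex_of_real (lam i)) (mset_set {1..d})"
    using roots[of es] es by (simp add: multiset.map_comp comp_def)
  moreover have "lam i \<le> lam j" if "i \<in> {1..d}" "j \<in> {1..d}" "i < j" for i j
    unfolding lam_def using that len by (intro sorted_nth_mono) (auto simp: xs_def)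
  ultimately show ?thesis unfolding ordered_eigenvalues_def by blast
qed

end

theory Submission
  imports Defs "Jordan_Normal_Form.Spectral_Radius" "HOL-Analysis.Convex"
begin

text \<open>
  Let \<open>e\<^sub>a\<close> be a unit eigenvector for the top eigenvalue \<open>\<lambda>\<^sub>d\<close> of the \<open>a\<close>th reduced density matrix and
  \<open>P\<^sub>a\<close> the projection onto \<open>e\<^sub>a\<close> at site \<open>a\<close>, so that \<open>\<parallel>P\<^sub>a \<Psi>\<parallel>\<^sup>2 = \<lambda>\<^sub>d\<close> and, the trace being one,
  \<open>\<parallel>\<Psi> - P\<^sub>a \<Psi>\<parallel>\<^sup>2\<close> is the sum of the other eigenvalues. The projections commute, hence
  \<open>x = P\<^sub>1 \<dots> P\<^bsub>n-1\<^esub> \<Psi>\<close> satisfies \<open>1 - \<parallel>x\<parallel>\<^sup>2 \<le> \<Sum>\<^sub>a \<parallel>\<Psi> - P\<^sub>a \<Psi>\<parallel>\<^sup>2\<close>. But \<open>x\<close> is a product vector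
  \<open>e\<^sub>1 \<otimes> \<dots> \<otimes> e\<^bsub>n-1\<^esub> \<otimes> u\<close>, so by Cauchy-Schwarz \<open>\<parallel>x\<parallel>\<^sup>4 = \<bar>\<langle>x, \<Psi>\<rangle>\<bar>\<^sup>2\<close> is at most the quadratic form
  of the \<open>n\<close>th reduced density matrix at \<open>u\<close>, which is at most its top eigenvalue times
  \<open>\<parallel>u\<parallel>\<^sup>2 = \<parallel>x\<parallel>\<^sup>2\<close>.
\<close>

section \<open>Hermitian matrices\<close>

text \<open>An arbitrary index set lets one inner product serve for vectors (\<open>{..<d}\<close>),
  for one-site vectors (\<open>{1..d}\<close>) and for amplitudes of states
  (\<open>multi_index d A\<close>).\<close>

definition cip :: "'a set \<Rightarrow> ('a \<Rightarrow> complex) \<Rightarrow> ('a \<Rightarrow> complex) \<Rightarrow> complex" where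
  "cip S f g = (\<Sum>x\<in>S. cnj (f x) * g x)"

definition sqnorm :: "'a set \<Rightarrow> ('a \<Rightarrow> complex) \<Rightarrow> real" where
  "sqnorm S f = (\<Sum>x\<in>S. (cmod (f x))\<^sup>2)"

lemma sqnorm_nonneg [simp]: "sqnorm S f \<ge> 0"
  by (simp add: sqnorm_def sum_nonneg)

lemma cip_self: "cip S f f = complex_of_real (sqnorm S f)"
  by (simp add: cip_def sqnorm_def complex_norm_square mult.commute del: of_real_power)

lemma cip_commute: "cip S g f = cnj (cip S f g)"
  by (simp add: cip_def mult.commute)

lemma cip_diff_left: "cip S (\<lambda>x. f x - g x) h = cip S f h - cip S g h"
  by (simp add: cip_def left_diff_distrib sum_subtractf)

lemma cip_diff_right: "cip S h (\<lambda>x. f x - g x) = cip S h f - cip S h g"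
  by (simp add: cip_def right_diff_distrib sum_subtractf)

lemma cip_Cauchy_Schwarz: "(cmod (cip S f g))\<^sup>2 \<le> sqnorm S f * sqnorm S g"
proof -
  have "cmod (cip S f g) \<le> (\<Sum>x\<in>S. cmod (f x) * cmod (g x))"
    unfolding cip_def by (rule sum_norm_le) (simp add: norm_mult)
  then have "(cmod (cip S f g))\<^sup>2 \<le> (\<Sum>x\<in>S. cmod (f x) * cmod (g x))\<^sup>2"
    by (simp add: power_mono)
  also have "\<dots> \<le> sqnorm S f * sqnorm S g"
    unfolding sqnorm_def by (rule Cauchy_Schwarz_ineq_sum)
  finally show ?thesis .
qed

definition hermitian :: "nat \<Rightarrow> complex mat \<Rightarrow> bool" where
  "hermitian d A \<longleftrightarrow> A \<in> carrier_mat d d \<and> (\<forall>i<d. \<forall>j<d. A $$ (j, i) = cnj (A $$ (i, j)))"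

lemma mult_mat_vec_nth:
  assumes "A \<in> carrier_mat d d" "v \<in> carrier_vec d" "i < d"
  shows "(A *\<^sub>v v) $ i = (\<Sum>j<d. A $$ (i, j) * v $ j)"
  using assms by (simp add: scalar_prod_def lessThan_atLeast0)

lemma hermitian_cip:
  assumes "hermitian d A" "u \<in> carrier_vec d" "w \<in> carrier_vec d"
  shows "cip {..<d} (($) (A *\<^sub>v u)) (($) w) = cip {..<d} (($) u) (($) (A *\<^sub>v w))"
proof -
  have A: "A \<in> carrier_mat d d" using assms(1) by (simp add: hermitian_def)
  have herm: "cnj (A $$ (i, j)) = A $$ (j, i)" if "i < d" "j < d" for i j
    using assms(1) that unfolding hermitian_def by metis
  have "cip {..<d} (($) (A *\<^sub>v u)) (($) w) = (\<Sum>i<d. \<Sum>j<d. A $$ (j, i) * cnj (u $ j) * w $ i)"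
    unfolding cip_def
    by (intro sum.cong) (simp_all add: mult_mat_vec_nth[OF A assms(2)] sum_distrib_right herm)
  also have "\<dots> = (\<Sum>j<d. \<Sum>i<d. A $$ (j, i) * cnj (u $ j) * w $ i)"
    by (rule sum.swap)
  also have "\<dots> = cip {..<d} (($) u) (($) (A *\<^sub>v w))"
    unfolding cip_def
    by (intro sum.cong) (auto simp: mult_mat_vec_nth[OF A assms(3)] sum_distrib_left ac_simps)
  finally show ?thesis .
qed

section \<open>Bounding a Hermitian quadratic form by iterated squaring\<close>

lemma funpow_mult_mat_vec:
  assumes A: "A \<in> carrier_mat d d" and v: "v \<in> carrier_vec d"
  shows "((*\<^sub>v) A ^^ k) v \<in> carrier_vec d" "((*\<^sub>v) A ^^ k) v = A ^\<^sub>m k *\<^sub>v v"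
proof -
  show c: "((*\<^sub>v) A ^^ k) v \<in> carrier_vec d" for k
    by (induction k) (use A v in auto)
  show "((*\<^sub>v) A ^^ k) v = A ^\<^sub>m k *\<^sub>v v" using v
  proof (induction k arbitrary: v)
    case 0
    then show ?case using A by simp
  next
    case (Suc k)
    have "((*\<^sub>v) A ^^ Suc k) v = ((*\<^sub>v) A ^^ k) (A *\<^sub>v v)" by (simp add: funpow_swap1)
    also have "\<dots> = A ^\<^sub>m k *\<^sub>v (A *\<^sub>v v)" using Suc A by simp
    also have "\<dots> = A ^\<^sub>m Suc k *\<^sub>v v"
      using A Suc.prems pow_carrier_mat[OF A, of k] by (simp add: assoc_mult_mat_vec[of _ d d _ d])
    finally show ?case .
  qed
qed

lemma hermitian_funpow_cip:
  assumes h: "hermitian d A" and "u \<in> carrier_vec d" "w \<in> carrier_vec d"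
  shows "cip {..<d} (($) (((*\<^sub>v) A ^^ k) u)) (($) w) = cip {..<d} (($) u) (($) (((*\<^sub>v) A ^^ k) w))"
  using assms(3)
proof (induction k arbitrary: w)
  case (Suc k)
  have A: "A \<in> carrier_mat d d" using h by (simp add: hermitian_def)
  note c = funpow_mult_mat_vec(1)[OF A assms(2)]
  have "cip {..<d} (($) (((*\<^sub>v) A ^^ Suc k) u)) (($) w)
      = cip {..<d} (($) (((*\<^sub>v) A ^^ k) u)) (($) (A *\<^sub>v w))"
    using hermitian_cip[OF h c Suc.prems] by simp
  also have "\<dots> = cip {..<d} (($) u) (($) (((*\<^sub>v) A ^^ Suc k) w))"
    using Suc A by (simp add: funpow_swap1)
  finally show ?case .
qed simp

text \<open>
  By Cauchy-Schwarz the numbers \<open>q k = \<bar>\<langle>v, A\<^bsup>2^k\<^esup> v\<rangle>\<bar>\<close> satisfy \<open>(q k)\<^sup>2 \<le> N * q (k + 1)\<close> with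
  \<open>N = \<langle>v, v\<rangle>\<close>, so they would grow without bound if \<open>q 0 > N\<close>.
\<close>

lemma hermitian_power_bounded_quadratic_form:
  assumes h: "hermitian d A" and v: "v \<in> carrier_vec d"
    and bd: "\<And>k. norm_bound (A ^\<^sub>m k) b"
  shows "cmod (cip {..<d} (($) v) (($) (A *\<^sub>v v))) \<le> sqnorm {..<d} (($) v)"
proof (rule ccontr)
  have A: "A \<in> carrier_mat d d" using h by (simp add: hermitian_def)
  define F where "F k = ((*\<^sub>v) A ^^ k) v" for k
  define p where "p k = cmod (cip {..<d} (($) v) (($) (F k)))" for k
  define q where "q k = p (2 ^ k)" for k
  define N where "N = sqnorm {..<d} (($) v)"
  \<comment> \<open>Since \<open>b\<close> bounds every entry of every power of \<open>A\<close>,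
    this number bounds \<open>p k\<close> for all \<open>k\<close> at once.\<close>
  define C where "C = (\<Sum>i<d. \<Sum>j<d. cmod (v $ i) * (b * cmod (v $ j)))"
  assume "\<not> ?thesis"
  then have q0: "q 0 > N" by (simp add: q_def p_def F_def N_def)
  have Fc: "F k \<in> carrier_vec d" for k
    unfolding F_def by (rule funpow_mult_mat_vec(1)[OF A v])
  have pC: "p k \<le> C" for k
  proof -
    have Ak: "A ^\<^sub>m k \<in> carrier_mat d d" using A by simp
    have "cip {..<d} (($) v) (($) (F k)) = (\<Sum>i<d. \<Sum>j<d. cnj (v $ i) * ((A ^\<^sub>m k) $$ (i, j) * v $ j))"
      unfolding cip_def F_def funpow_mult_mat_vec(2)[OF A v]
      by (intro sum.cong) (auto simp: mult_mat_vec_nth[OF Ak v] sum_distrib_left)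
    also have "cmod \<dots> \<le> C"
      unfolding C_def
    proof (intro sum_norm_le)
      fix i j assume "i \<in> {..<d}" "j \<in> {..<d}"
      then have "cmod ((A ^\<^sub>m k) $$ (i, j)) \<le> b"
        using bd[of k] carrier_matD[OF Ak] unfolding norm_bound_def by simp
      then show "cmod (cnj (v $ i) * ((A ^\<^sub>m k) $$ (i, j) * v $ j)) \<le> cmod (v $ i) * (b * cmod (v $ j))"
        by (simp add: norm_mult mult_left_mono mult_right_mono)
    qed
    finally show ?thesis by (simp add: p_def)
  qed
  have step: "(q k)\<^sup>2 \<le> N * q (Suc k)" for k
  proof -
    \<comment> \<open>Half of the \<open>2 ^ Suc k\<close> factors move to the left argument, so
      \<open>q (Suc k)\<close> is the squared norm of \<open>F (2^k)\<close>.\<close>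
    have "cip {..<d} (($) (F (2^k))) (($) (F (2^k))) = cip {..<d} (($) v) (($) (F (2 ^ Suc k)))"
      using hermitian_funpow_cip[OF h v Fc, of "2^k" "2^k"]
      by (simp add: F_def mult_2 funpow_add)
    then have "complex_of_real (sqnorm {..<d} (($) (F (2^k)))) = cip {..<d} (($) v) (($) (F (2 ^ Suc k)))"
      by (simp add: cip_self)
    from arg_cong[OF this, of cmod]
    have "sqnorm {..<d} (($) (F (2^k))) = q (Suc k)"
      unfolding q_def p_def by simp
    then show ?thesis
      using cip_Cauchy_Schwarz[of "{..<d}" "($) v" "($) (F (2^k))"] by (simp add: q_def p_def N_def)
  qed
  have N0: "N \<ge> 0" by (simp add: N_def)
  have "N \<noteq> 0" using step[of 0] q0 by auto
  with N0 have N: "N > 0" by simp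
  \<comment> \<open>Divided by \<open>N\<close>, the inequality \<open>step\<close> says that
    \<open>q (Suc k) / N\<close> is at least the square of \<open>q k / N\<close>, which starts at
    \<open>r\<close>.\<close>
  define r where "r = q 0 / N"
  have r: "r > 1" using q0 N by (simp add: r_def)
  have grow: "r ^ (2 ^ k) * N \<le> q k" for k
  proof (induction k)
    case 0
    then show ?case using N by (simp add: r_def)
  next
    case (Suc k)
    have "(r ^ (2 ^ k) * N)\<^sup>2 \<le> (q k)\<^sup>2"
      using Suc r N by (intro power_mono) auto
    also note step[of k]
    finally have "N * (r ^ (2 ^ Suc k) * N) \<le> N * q (Suc k)"
      by (simp add: power2_eq_square mult_2 power_add ac_simps)
    then show ?case using N by simp
  qed
  obtain k where k: "C / N < r ^ k" using real_arch_pow[OF r] by blast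
  have "r ^ k \<le> r ^ (2 ^ k)" using r by (intro power_increasing) (auto simp: less_imp_le)
  with k N have "C < r ^ (2 ^ k) * N"
    by (meson less_le_trans pos_divide_less_eq)
  with grow[of k] pC[of "2 ^ k"] show False by (simp add: q_def)
qed

text \<open>For \<open>t > s\<close> the matrix \<open>A / t\<close> has spectral radius below one,
  so its powers are bounded and the previous lemma applies to it. Rescaling gives the bound with
  \<open>t\<close>, and \<open>t\<close> may then decrease to \<open>s\<close>.\<close>

lemma hermitian_quadratic_form_le:
  assumes h: "hermitian d A" and v: "v \<in> carrier_vec d"
    and ev: "\<And>k. eigenvalue A k \<Longrightarrow> cmod k \<le> s" and s: "s \<ge> 0"
  shows "cmod (cip {..<d} (($) v) (($) (A *\<^sub>v v))) \<le> s * sqnorm {..<d} (($) v)"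
\<comment> \<open>The spectral radius is a maximum over the spectrum, which must be
  nonempty.\<close>
proof (cases "d = 0")
  case True
  then show ?thesis by (simp add: cip_def sqnorm_def)
next
  case False
  have A: "A \<in> carrier_mat d d" using h by (simp add: hermitian_def)
  let ?Q = "cmod (cip {..<d} (($) v) (($) (A *\<^sub>v v)))"
  let ?N = "sqnorm {..<d} (($) v)"
  have bound: "?Q \<le> t * ?N" if t: "t > s" for t
  proof -
    have t0: "t > 0" using t s by simp
    define B where "B = complex_of_real (1 / t) \<cdot>\<^sub>m A"
    have B: "B \<in> carrier_mat d d" using A by (simp add: B_def)
    have hB: "hermitian d B" unfolding hermitian_def
    proof (intro conjI allI impI B)
      fix i j assume ij: "i < d" "j < d"
      then have "A $$ (j, i) = cnj (A $$ (i, j))" using h unfolding hermitian_def by blast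
      then show "B $$ (j, i) = cnj (B $$ (i, j))" using ij A by (simp add: B_def)
    qed
    have "spectral_radius B < 1"
    proof -
      obtain k where k: "k \<in> spectrum B" "spectral_radius B = cmod k"
        using spectral_radius_mem_max(1)[OF B] False by auto
      then obtain u where u: "u \<in> carrier_vec d" "u \<noteq> 0\<^sub>v d" "B *\<^sub>v u = k \<cdot>\<^sub>v u"
        using B unfolding spectrum_def eigenvalue_def eigenvector_def by auto
      \<comment> \<open>An eigenvalue \<open>k\<close> of \<open>B\<close> of largest modulus gives
        the eigenvalue \<open>t * k\<close> of \<open>A\<close>, hence
        \<open>t * cmod k \<le> s < t\<close>.\<close>
      have "A *\<^sub>v u = (complex_of_real t * k) \<cdot>\<^sub>v u"
      proof (rule eq_vecI)
        fix i assume i: "i < dim_vec ((complex_of_real t * k) \<cdot>\<^sub>v u)"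
        then have i: "i < d" using u by simp
        have "(B *\<^sub>v u) $ i = (k \<cdot>\<^sub>v u) $ i" using u(3) by simp
        moreover have "(B *\<^sub>v u) $ i = complex_of_real (1 / t) * (A *\<^sub>v u) $ i"
          unfolding mult_mat_vec_nth[OF B u(1) i] mult_mat_vec_nth[OF A u(1) i] sum_distrib_left
          using A i by (intro sum.cong) (auto simp: B_def)
        ultimately show "(A *\<^sub>v u) $ i = ((complex_of_real t * k) \<cdot>\<^sub>v u) $ i"
          using u i t0 by (simp add: field_simps)
      qed (use u A in auto)
      then have "eigenvalue A (complex_of_real t * k)"
        using u A unfolding eigenvalue_def eigenvector_def by auto
      then have "t * cmod k \<le> s" using ev[of "complex_of_real t * k"] t0 by (simp add: norm_mult)
      then have "t * cmod k < t * 1" using t by simp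
      then have "cmod k < 1" using t0 by (simp only: mult_less_cancel_left_pos)
      then show ?thesis using k by simp
    qed
    then obtain b where "\<And>k. norm_bound (B ^\<^sub>m k) b"
      using spectral_radius_jnf_norm_bound_less_1_upper_triangular[OF B] by auto
    from hermitian_power_bounded_quadratic_form[OF hB v this]
    have le: "cmod (cip {..<d} (($) v) (($) (B *\<^sub>v v))) \<le> ?N" .
    have "cip {..<d} (($) v) (($) (B *\<^sub>v v)) = complex_of_real (1 / t) * cip {..<d} (($) v) (($) (A *\<^sub>v v))"
      unfolding cip_def sum_distrib_left
    proof (intro sum.cong refl)
      fix i assume "i \<in> {..<d}"
      then have i: "i < d" by simp
      have "(B *\<^sub>v v) $ i = complex_of_real (1 / t) * (A *\<^sub>v v) $ i"
        unfolding mult_mat_vec_nth[OF B v i] mult_mat_vec_nth[OF A v i] sum_distrib_left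
        using A i by (intro sum.cong) (auto simp: B_def)
      then show "cnj (v $ i) * (B *\<^sub>v v) $ i = complex_of_real (1 / t) * (cnj (v $ i) * (A *\<^sub>v v) $ i)"
        by simp
    qed
    with le t0 show ?thesis by (simp add: norm_mult norm_divide field_simps)
  qed
  show ?thesis
  \<comment> \<open>The passage to the limit divides by \<open>?N\<close>. If \<open>?N = 0\<close>,
    a single \<open>t > s\<close> already gives \<open>?Q \<le> 0\<close>.\<close>
  proof (cases "?N = 0")
    case True
    then show ?thesis using bound[of "s + 1"] by simp
  next
    case False
    then have N: "?N > 0" using sqnorm_nonneg[of "{..<d}" "($) v"] by linarith
    have "?Q / ?N \<le> s"
      by (rule dense_ge) (use bound N in \<open>simp add: field_simps\<close>)
    then show ?thesis using N by (simp add: field_simps)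
  qed
qed

section \<open>Eigenvalues with multiplicity\<close>

lemma proots_prod_list_linear: "proots (\<Prod>a\<leftarrow>bs. [:- a, 1:]) = mset bs" for bs :: "complex list"
proof (induction bs)
  case (Cons b bs)
  have "(\<Prod>a\<leftarrow>bs. [:- a, 1:]) \<noteq> 0" by (auto simp: prod_list_zero_iff)
  then have "proots ([:- b, 1:] * (\<Prod>a\<leftarrow>bs. [:- a, 1:])) = {#b#} + mset bs"
    by (subst proots_mult) (use Cons in \<open>auto simp: proots_linear_factor\<close>)
  then show ?case by simp
qed simp

lemma trace_comm:
  fixes A B :: "'a :: comm_semiring_0 mat"
  assumes "A \<in> carrier_mat d d" "B \<in> carrier_mat d d"
  shows "(\<Sum>i<d. (A * B) $$ (i, i)) = (\<Sum>i<d. (B * A) $$ (i, i))"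
proof -
  have e: "(\<Sum>i<d. (A * B) $$ (i, i)) = (\<Sum>i<d. \<Sum>j<d. A $$ (i, j) * B $$ (j, i))"
    if "A \<in> carrier_mat d d" "B \<in> carrier_mat d d" for A B :: "'a mat"
    using that by (intro sum.cong) (auto simp: scalar_prod_def lessThan_atLeast0)
  show ?thesis
    unfolding e[OF assms] e[OF assms(2,1)] by (subst sum.swap) (simp add: mult.commute)
qed

text \<open>Schur triangularization: the diagonal of a similar upper triangular matrix lists the
  roots of the characteristic polynomial, and similarity preserves the trace.\<close>

lemma sum_mset_proots_char_poly:
  fixes A :: "complex mat"
  assumes A: "A \<in> carrier_mat d d"
  shows "sum_mset (proots (char_poly A)) = (\<Sum>i<d. A $$ (i, i))"
proof -
  obtain es where es: "char_poly A = (\<Prod>a\<leftarrow>es. [:- a, 1:])"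
    using char_poly_factorized[OF A] by blast
  obtain B where B: "B \<in> carrier_mat d d" "upper_triangular B" "similar_mat A B"
    using schur_decomposition_exists[OF A es] by blast
  obtain P Q where PQ: "P \<in> carrier_mat d d" "Q \<in> carrier_mat d d" "Q * P = 1\<^sub>m d" "A = P * B * Q"
    using B(3) A unfolding similar_mat_def similar_mat_wit_def by (auto simp: Let_def)
  have "proots (char_poly A) = mset (diag_mat B)"
    using char_poly_similar[OF B(3)] char_poly_upper_triangular[OF B(1,2)] proots_prod_list_linear
    by metis
  then have "sum_mset (proots (char_poly A)) = sum_list (diag_mat B)"
    by (simp add: sum_mset_sum_list)
  also have "\<dots> = (\<Sum>i<d. B $$ (i, i))"
    using B(1) by (simp add: diag_mat_def sum_list_sum_nth lessThan_atLeast0)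
  \<comment> \<open>Regrouped as \<open>Q\<close> times \<open>P * B\<close>, the two factors can be
    exchanged under the trace, which produces \<open>P * B * Q = A\<close>.\<close>
  also have "B = (Q * P) * B" using B(1) PQ by simp
  also have "\<dots> = Q * (P * B)" by (rule assoc_mult_mat[OF PQ(2,1) B(1)])
  also have "(\<Sum>i<d. (Q * (P * B)) $$ (i, i)) = (\<Sum>i<d. A $$ (i, i))"
    using trace_comm[of Q d "P * B"] PQ B(1) by simp
  finally show ?thesis .
qed

lemma ordered_eigenvalues_sum:
  assumes A: "A \<in> carrier_mat d d" and "ordered_eigenvalues d A lam"
  shows "complex_of_real (\<Sum>i = 1..d. lam i) = (\<Sum>i<d. A $$ (i, i))"
proof -
  have "sum_mset (proots (char_poly A)) = (\<Sum>i = 1..d. complex_of_real (lam i))"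
    using assms(2) by (simp add: ordered_eigenvalues_def sum_unfold_sum_mset)
  then show ?thesis using sum_mset_proots_char_poly[OF A] by simp
qed

lemma ordered_eigenvalues_eigenvalue_iff:
  assumes A: "A \<in> carrier_mat d d" and "ordered_eigenvalues d A lam"
  shows "eigenvalue A k \<longleftrightarrow> (\<exists>i\<in>{1..d}. k = complex_of_real (lam i))"
proof -
  have "char_poly A \<noteq> 0" using degree_monic_char_poly[OF A] by auto
  then have "eigenvalue A k \<longleftrightarrow> k \<in># proots (char_poly A)"
    by (simp add: eigenvalue_root_char_poly[OF A])
  also have "\<dots> \<longleftrightarrow> (\<exists>i\<in>{1..d}. k = complex_of_real (lam i))"
    using assms(2) by (auto simp: ordered_eigenvalues_def)
  finally show ?thesis .
qed


section \<open>Projections onto one-site vectors\<close>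

lemma sum_from_1: "(\<Sum>i = 1..d. h i) = (\<Sum>i<d. h (Suc i))" for d :: nat
  by (simp add: sum.atLeast1_atMost_eq)

text \<open>This isolates the one coordinate on which an operator at site \<open>a\<close> acts, so
  that its properties reduce to sums over \<open>{1..d}\<close>.\<close>

lemma sum_multi_index_split:
  assumes "a \<in> A"
  shows "(\<Sum>f\<in>multi_index d A. h f) = (\<Sum>g\<in>multi_index d (A - {a}). \<Sum>i = 1..d. h (g(a := i)))"
proof -
  let ?S = "A - {a}"
  have "multi_index d A = (\<lambda>(y, g). g(a := y)) ` ({1..d} \<times> (?S \<rightarrow>\<^sub>E {1..d}))"
    using PiE_insert_eq[of a ?S "\<lambda>_. {1..d}"] assms by (simp add: multi_index_def insert_absorb)
  moreover have "inj_on (\<lambda>(y, g). g(a := y)) ({1..d} \<times> (?S \<rightarrow>\<^sub>E {1..d}))"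
    using inj_combinator[of a ?S "\<lambda>_. {1..d}"] by simp
  ultimately have "(\<Sum>f\<in>multi_index d A. h f)
      = (\<Sum>(y, g)\<in>{1..d} \<times> (?S \<rightarrow>\<^sub>E {1..d}). h (g(a := y)))"
    by (simp add: sum.reindex case_prod_unfold)
  also have "\<dots> = (\<Sum>i = 1..d. \<Sum>g\<in>multi_index d ?S. h (g(a := i)))"
    by (simp add: sum.cartesian_product multi_index_def)
  finally show ?thesis by (simp only: sum.swap[of _ "{1..d}"])
qed

text \<open>The rank-one operator \<open>|u><u|\<close> at site \<open>a\<close>, tensored with the
  identity at all other sites; it is a projection when \<open>u\<close> is a unit vector.\<close>

definition site_proj ::
    "nat \<Rightarrow> (nat \<Rightarrow> complex) \<Rightarrow> nat \<Rightarrow> ((nat \<Rightarrow> nat) \<Rightarrow> complex) \<Rightarrow> (nat \<Rightarrow> nat) \<Rightarrow> complex" where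
  "site_proj d u a c f = u (f a) * (\<Sum>i = 1..d. cnj (u i) * c (f(a := i)))"

lemma site_proj_idem:
  assumes "sqnorm {1..d} u = 1"
  shows "site_proj d u a (site_proj d u a c) = site_proj d u a c"
proof
  fix f
  have "site_proj d u a (site_proj d u a c) f
      = u (f a) * (cip {1..d} u u * (\<Sum>i = 1..d. cnj (u i) * c (f(a := i))))"
    by (simp add: site_proj_def cip_def sum_distrib_right mult.assoc)
  then show "site_proj d u a (site_proj d u a c) f = site_proj d u a c f"
    using assms by (simp add: cip_self site_proj_def)
qed

lemma site_proj_commute:
  assumes "a \<noteq> b"
  shows "site_proj d u a (site_proj d v b c) = site_proj d v b (site_proj d u a c)"
proof
  fix f
  have "site_proj d u a (site_proj d v b c) f
     = (\<Sum>i = 1..d. \<Sum>j = 1..d. u (f a) * v (f b) * cnj (u i) * cnj (v j) * c (f(a := i, b := j)))"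
    using assms by (simp add: site_proj_def sum_distrib_left ac_simps)
  also have "\<dots> = (\<Sum>j = 1..d. \<Sum>i = 1..d. u (f a) * v (f b) * cnj (u i) * cnj (v j) * c (f(b := j, a := i)))"
    by (subst sum.swap) (simp add: fun_upd_twist[OF assms])
  also have "\<dots> = site_proj d v b (site_proj d u a c) f"
    using assms by (simp add: site_proj_def sum_distrib_left ac_simps)
  finally show "site_proj d u a (site_proj d v b c) f = site_proj d v b (site_proj d u a c) f" .
qed

lemma site_proj_diff:
  "site_proj d u a (\<lambda>f. c f - c' f) = (\<lambda>f. site_proj d u a c f - site_proj d u a c' f)"
  by (simp add: site_proj_def fun_eq_iff right_diff_distrib sum_subtractf)

text \<open>With the other coordinates fixed, the operator has the Hermitian kernel
  \<open>u i * cnj (u j)\<close>.\<close>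

lemma site_proj_self_adjoint:
  assumes "a \<in> A"
  shows "cip (multi_index d A) (site_proj d u a c) c' = cip (multi_index d A) c (site_proj d u a c')"
  unfolding cip_def sum_multi_index_split[OF assms]
proof (rule sum.cong[OF refl])
  fix g
  have "(\<Sum>i = 1..d. cnj (site_proj d u a c (g(a := i))) * c' (g(a := i)))
     = (\<Sum>i = 1..d. \<Sum>j = 1..d. cnj (u i) * u j * cnj (c (g(a := j))) * c' (g(a := i)))"
    by (simp add: site_proj_def sum_distrib_left sum_distrib_right ac_simps)
  also have "\<dots> = (\<Sum>j = 1..d. \<Sum>i = 1..d. cnj (u i) * u j * cnj (c (g(a := j))) * c' (g(a := i)))"
    by (rule sum.swap)
  also have "\<dots> = (\<Sum>i = 1..d. cnj (c (g(a := i))) * site_proj d u a c' (g(a := i)))"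
    by (simp add: site_proj_def sum_distrib_left sum_distrib_right ac_simps)
  finally show "(\<Sum>i = 1..d. cnj (site_proj d u a c (g(a := i))) * c' (g(a := i)))
    = (\<Sum>i = 1..d. cnj (c (g(a := i))) * site_proj d u a c' (g(a := i)))" .
qed

text \<open>By self-adjointness and idempotence both cross terms equal the inner product of the
  projected state with itself.\<close>

lemma site_proj_pythagoras:
  assumes "a \<in> A" and u: "sqnorm {1..d} u = 1"
  shows "sqnorm (multi_index d A) c = sqnorm (multi_index d A) (site_proj d u a c)
    + sqnorm (multi_index d A) (\<lambda>f. c f - site_proj d u a c f)"
proof -
  let ?M = "multi_index d A" and ?P = "site_proj d u a"
  have "cip ?M (?P c) c = cip ?M (?P c) (?P c)"
    by (metis site_proj_self_adjoint[OF assms(1)] site_proj_idem[OF u])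
  moreover have "cip ?M c (?P c) = cip ?M (?P c) (?P c)"
    by (metis site_proj_self_adjoint[OF assms(1)] site_proj_idem[OF u])
  ultimately have "cip ?M c c = cip ?M (?P c) (?P c) + cip ?M (\<lambda>f. c f - ?P c f) (\<lambda>f. c f - ?P c f)"
    by (simp add: cip_diff_left cip_diff_right)
  then show ?thesis unfolding cip_self of_real_add[symmetric] of_real_eq_iff .
qed

text \<open>The unit factor \<open>u\<close> at site \<open>a\<close> sums out. What remains is also
  the quadratic form of the reduced density matrix at \<open>u\<close>, which is how eigenvalues
  become norms of projected states.\<close>

lemma sqnorm_site_proj:
  assumes "a \<in> A" and u: "sqnorm {1..d} u = 1"
  shows "sqnorm (multi_index d A) (site_proj d u a c)
    = (\<Sum>g\<in>multi_index d (A - {a}). (cmod (\<Sum>i = 1..d. cnj (u i) * c (g(a := i))))\<^sup>2)"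
proof -
  have "(\<Sum>i = 1..d. (cmod (site_proj d u a c (g(a := i))))\<^sup>2)
      = sqnorm {1..d} u * (cmod (\<Sum>i = 1..d. cnj (u i) * c (g(a := i))))\<^sup>2" for g
    by (simp add: site_proj_def norm_mult power_mult_distrib sqnorm_def sum_distrib_right)
  then show ?thesis
    unfolding sqnorm_def[of "multi_index d A"] sum_multi_index_split[OF assms(1)] using u by simp
qed

section \<open>Successive projections at the sites \<open>1..m\<close>\<close>

primrec site_projs ::
    "nat \<Rightarrow> (nat \<Rightarrow> nat \<Rightarrow> complex) \<Rightarrow> nat \<Rightarrow> ((nat \<Rightarrow> nat) \<Rightarrow> complex) \<Rightarrow> (nat \<Rightarrow> nat) \<Rightarrow> complex" where
  "site_projs d e 0 c = c"
| "site_projs d e (Suc m) c = site_proj d (e (Suc m)) (Suc m) (site_projs d e m c)"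

lemma site_projs_diff:
  "site_projs d e m (\<lambda>f. c f - c' f) = (\<lambda>f. site_projs d e m c f - site_projs d e m c' f)"
  by (induction m) (simp_all add: site_proj_diff)

lemma site_projs_commute:
  "a > m \<Longrightarrow> site_proj d u a (site_projs d e m c) = site_projs d e m (site_proj d u a c)"
proof (induction m)
  case (Suc m)
  then show ?case using site_proj_commute[of a "Suc m" d u] by simp
qed simp

text \<open>Commutation brings the projection at \<open>a\<close> next to its own copy, which
  absorbs it by idempotence.\<close>

lemma site_projs_fixed:
  assumes "\<And>a. a \<in> {1..m} \<Longrightarrow> sqnorm {1..d} (e a) = 1" and "a \<in> {1..m}"
  shows "site_proj d (e a) a (site_projs d e m c) = site_projs d e m c"
  using assms
proof (induction m)
  case (Suc m)
  show ?case
  proof (cases "a = Suc m")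
    case True
    then show ?thesis using Suc.prems by (simp add: site_proj_idem)
  next
    case False
    then have "site_proj d (e a) a (site_projs d e m c) = site_projs d e m c"
      using Suc by auto
    then show ?thesis using site_proj_commute[OF False] by simp
  qed
qed simp

lemma sqnorm_site_projs_le:
  assumes "\<And>a. a \<in> {1..m} \<Longrightarrow> sqnorm {1..d} (e a) = 1" and "{1..m} \<subseteq> A"
  shows "sqnorm (multi_index d A) (site_projs d e m c) \<le> sqnorm (multi_index d A) c"
  using assms
proof (induction m)
  case (Suc m)
  have "sqnorm (multi_index d A) (site_projs d e (Suc m) c) \<le> sqnorm (multi_index d A) (site_projs d e m c)"
    using site_proj_pythagoras[of "Suc m" A d "e (Suc m)" "site_projs d e m c"] Suc.prems
    by (simp add: subset_iff)
  then show ?case using Suc by (force simp: subset_iff)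
qed simp

text \<open>The loss of squared norm telescopes over the sites. Commuting the earlier projections
  past the new one, the loss at each step is the squared norm of their image of the defect
  \<open>c - ?P c\<close>, and they do not increase norms.\<close>

lemma sqnorm_site_projs_ge:
  assumes "\<And>a. a \<in> {1..m} \<Longrightarrow> sqnorm {1..d} (e a) = 1" and "{1..m} \<subseteq> A"
  shows "sqnorm (multi_index d A) c - sqnorm (multi_index d A) (site_projs d e m c)
    \<le> (\<Sum>a = 1..m. sqnorm (multi_index d A) (\<lambda>f. c f - site_proj d (e a) a c f))"
  using assms
proof (induction m)
  case (Suc m)
  let ?N = "sqnorm (multi_index d A)" and ?P = "site_proj d (e (Suc m)) (Suc m)"
  have prems: "\<And>a. a \<in> {1..m} \<Longrightarrow> sqnorm {1..d} (e a) = 1" "{1..m} \<subseteq> A"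
    using Suc.prems by auto
  have "?N (site_projs d e m c) - ?N (site_projs d e (Suc m) c)
      = ?N (\<lambda>f. site_projs d e m c f - ?P (site_projs d e m c) f)"
    using site_proj_pythagoras[of "Suc m" A d "e (Suc m)" "site_projs d e m c"] Suc.prems
    by (simp add: subset_iff)
  also have "\<dots> = ?N (site_projs d e m (\<lambda>f. c f - ?P c f))"
    by (simp add: site_projs_commute site_projs_diff)
  also have "\<dots> \<le> ?N (\<lambda>f. c f - ?P c f)"
    by (rule sqnorm_site_projs_le[OF prems])
  finally show ?case using Suc.IH[OF prems] by simp
qed simp

lemma cip_site_projs_fixed:
  assumes "{1..m} \<subseteq> A" and "\<And>a. a \<in> {1..m} \<Longrightarrow> site_proj d (e a) a x = x"
  shows "cip (multi_index d A) (site_projs d e m c) x = cip (multi_index d A) c x"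
  using assms
proof (induction m)
  case (Suc m)
  have "cip (multi_index d A) (site_projs d e (Suc m) c) x
      = cip (multi_index d A) (site_projs d e m c) (site_proj d (e (Suc m)) (Suc m) x)"
    using Suc.prems(1) by (simp add: site_proj_self_adjoint subset_iff)
  also have "site_proj d (e (Suc m)) (Suc m) x = x" using Suc.prems(2) by simp
  finally show ?case using Suc by (simp add: subset_iff)
qed simp

text \<open>The projected state is fixed by every factor, so in its inner product with itself the
  projections on the left can be removed one by one.\<close>

lemma cip_site_projs:
  assumes "\<And>a. a \<in> {1..m} \<Longrightarrow> sqnorm {1..d} (e a) = 1" and "{1..m} \<subseteq> A"
  shows "cip (multi_index d A) (site_projs d e m c) c
    = complex_of_real (sqnorm (multi_index d A) (site_projs d e m c))"
proof -
  let ?M = "multi_index d A" and ?x = "site_projs d e m c"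
  have "cip ?M ?x ?x = cip ?M c ?x"
    using cip_site_projs_fixed[OF assms(2), of d e ?x c] site_projs_fixed[of m d e] assms(1) by auto
  then have "cip ?M ?x c = cnj (cip ?M ?x ?x)" using cip_commute[of ?M c ?x] by simp
  then show ?thesis by (simp add: cip_self)
qed

text \<open>The factor \<open>y\<close> is the unnormalized vector left on the other sites; the
  second conjunct says that it ignores the coordinates already projected.\<close>

lemma site_projs_product_form:
  "\<exists>y. (\<forall>f. site_projs d e m c f = (\<Prod>a = 1..m. e a (f a)) * y f) \<and>
       (\<forall>f g. (\<forall>a. a \<notin> {1..m} \<longrightarrow> f a = g a) \<longrightarrow> y f = y g)"
proof (induction m)
  case 0
  have "f = g" if "\<forall>a::nat. f a = (g a :: nat)" for f g using that by auto
  then show ?case by auto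
next
  case (Suc m)
  then obtain y where y: "\<And>f. site_projs d e m c f = (\<Prod>a = 1..m. e a (f a)) * y f"
    "\<And>f g. (\<And>a. a \<notin> {1..m} \<Longrightarrow> f a = g a) \<Longrightarrow> y f = y g" by blast
  \<comment> \<open>The new remainder is the partial inner product of \<open>y\<close> with
    \<open>e (Suc m)\<close>; summing over that coordinate removes the dependence on it.\<close>
  define z where "z f = (\<Sum>i = 1..d. cnj (e (Suc m) i) * y (f(Suc m := i)))" for f
  have "site_projs d e (Suc m) c f = (\<Prod>a = 1..Suc m. e a (f a)) * z f" for f
  proof -
    have "(\<Prod>a = 1..m. e a ((f(Suc m := i)) a)) = (\<Prod>a = 1..m. e a (f a))" for i
      by (intro prod.cong) auto
    then show ?thesis
      by (simp add: site_proj_def y(1) z_def sum_distrib_left ac_simps)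
  qed
  moreover have "z f = z g" if "\<forall>a. a \<notin> {1..Suc m} \<longrightarrow> f a = g a" for f g
    unfolding z_def by (intro sum.cong arg_cong2[where f = "(*)"] refl y(2)) (use that in auto)
  ultimately show ?case by blast
qed

section \<open>Reduced density matrices\<close>

lemma reduced_density_carrier: "reduced_density n d c a \<in> carrier_mat d d"
  by (simp add: reduced_density_def)

lemma hermitian_reduced_density: "hermitian d (reduced_density n d c a)"
  by (simp add: hermitian_def reduced_density_def mult.commute)

lemma reduced_density_trace:
  assumes "a \<in> {1..n}"
  shows "(\<Sum>i<d. reduced_density n d c a $$ (i, i)) = complex_of_real (sqnorm (multi_index d {1..n}) c)"
proof -
  have "(\<Sum>i<d. reduced_density n d c a $$ (i, i))
     = (\<Sum>i<d. \<Sum>g\<in>multi_index d ({1..n} - {a}). c (g(a := Suc i)) * cnj (c (g(a := Suc i))))"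
    by (simp add: reduced_density_def)
  also have "\<dots> = (\<Sum>g\<in>multi_index d ({1..n} - {a}). \<Sum>i<d. c (g(a := Suc i)) * cnj (c (g(a := Suc i))))"
    by (rule sum.swap)
  also have "\<dots> = cip (multi_index d {1..n}) c c"
    unfolding cip_def sum_multi_index_split[OF assms] sum_from_1 by (simp add: mult.commute)
  finally show ?thesis by (simp add: cip_self)
qed

text \<open>The reduced density matrix is a sum over \<open>g\<close> of rank-one matrices built
  from the slices \<open>c (g(a := i))\<close>, so its form is a sum of squared overlaps with
  \<open>u\<close>. \<open>Suc\<close> translates from 0-based vector indices.\<close>

lemma reduced_density_quadratic_form:
  "cip {..<d} (($) (vec d (\<lambda>i. u (Suc i)))) (($) (reduced_density n d c a *\<^sub>v vec d (\<lambda>i. u (Suc i))))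
    = complex_of_real (\<Sum>g\<in>multi_index d ({1..n} - {a}). (cmod (\<Sum>i = 1..d. cnj (u i) * c (g(a := i))))\<^sup>2)"
  (is "?L = _")
proof -
  let ?M = "multi_index d ({1..n} - {a})"
  let ?t = "\<lambda>g i j. cnj (u (Suc i)) * c (g(a := Suc i)) * cnj (cnj (u (Suc j)) * c (g(a := Suc j)))"
  have v: "vec d (\<lambda>i. u (Suc i)) \<in> carrier_vec d" by simp
  have entry: "reduced_density n d c a $$ (i, j) = (\<Sum>g\<in>?M. c (g(a := Suc i)) * cnj (c (g(a := Suc j))))"
    if "i < d" "j < d" for i j using that by (simp add: reduced_density_def)
  have "?L = (\<Sum>i<d. \<Sum>j<d. \<Sum>g\<in>?M. ?t g i j)"
    unfolding cip_def
    by (intro sum.cong)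
      (simp_all add: mult_mat_vec_nth[OF reduced_density_carrier v] entry
        sum_distrib_left sum_distrib_right ac_simps del: index_mult_mat_vec)
  also have "\<dots> = (\<Sum>i<d. \<Sum>g\<in>?M. \<Sum>j<d. ?t g i j)"
    by (intro sum.cong refl sum.swap)
  also have "\<dots> = (\<Sum>g\<in>?M. \<Sum>i<d. \<Sum>j<d. ?t g i j)"
    by (rule sum.swap)
  also have "\<dots> = (\<Sum>g\<in>?M. (\<Sum>i = 1..d. cnj (u i) * c (g(a := i))) * cnj (\<Sum>i = 1..d. cnj (u i) * c (g(a := i))))"
    by (simp only: sum_from_1 cnj_sum sum_product)
  finally show ?thesis by (simp add: complex_norm_square del: of_real_power)
qed

lemma reduced_density_eigenvector:
  assumes "eigenvalue (reduced_density n d c a) k"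
  obtains u where "sqnorm {1..d} u = 1"
    "k = complex_of_real (\<Sum>g\<in>multi_index d ({1..n} - {a}). (cmod (\<Sum>i = 1..d. cnj (u i) * c (g(a := i))))\<^sup>2)"
proof -
  let ?R = "reduced_density n d c a"
  obtain v where v: "v \<in> carrier_vec d" "v \<noteq> 0\<^sub>v d" "?R *\<^sub>v v = k \<cdot>\<^sub>v v"
    using assms reduced_density_carrier[of n d c a] unfolding eigenvalue_def eigenvector_def by auto
  define N where "N = sqnorm {..<d} (($) v)"
  have "N \<noteq> 0"
  proof
    assume "N = 0"
    then have "\<forall>i<d. v $ i = 0"
      unfolding N_def sqnorm_def by (subst (asm) sum_nonneg_eq_0_iff) auto
    with v(1) have "v = 0\<^sub>v d" by (intro eq_vecI) auto
    with v(2) show False by simp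
  qed
  then have N: "N > 0" using sqnorm_nonneg[of "{..<d}" "($) v"] by (simp add: N_def less_le)
  \<comment> \<open>Normalized eigenvector; \<open>i - 1\<close> converts site values in
    \<open>{1..d}\<close> to vector indices.\<close>
  define u where "u i = complex_of_real (1 / sqrt N) * v $ (i - 1)" for i
  have "sqnorm {1..d} u = (\<Sum>i<d. 1 / N * (cmod (v $ i))\<^sup>2)"
    unfolding sqnorm_def sum_from_1 u_def
    using N by (simp add: norm_mult norm_divide power_mult_distrib power_divide)
  also have "\<dots> = 1" using N by (simp add: N_def sqnorm_def flip: sum_divide_distrib)
  finally have u1: "sqnorm {1..d} u = 1" .
  define w where "w = vec d (\<lambda>i. u (Suc i))"
  have w: "w = complex_of_real (1 / sqrt N) \<cdot>\<^sub>v v"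
    using v(1) by (intro eq_vecI) (auto simp: w_def u_def)
  have "?R *\<^sub>v w = k \<cdot>\<^sub>v w"
    unfolding w mult_mat_vec[OF reduced_density_carrier v(1)] v(3)
    by (simp add: smult_smult_assoc mult.commute)
  moreover have "cip {..<d} (($) w) (($) (k \<cdot>\<^sub>v w)) = k * cip {..<d} (($) w) (($) w)"
    unfolding cip_def sum_distrib_left by (intro sum.cong) (auto simp: w_def)
  moreover have "cip {..<d} (($) w) (($) w) = complex_of_real (sqnorm {1..d} u)"
    unfolding cip_self unfolding sqnorm_def sum_from_1 by (simp add: w_def)
  ultimately have "cip {..<d} (($) w) (($) (?R *\<^sub>v w)) = k" using u1 by simp
  then show ?thesis
    using that[OF u1] reduced_density_quadratic_form[of d u n c a] by (simp add: w_def)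
qed

text \<open>Each eigenvalue is a sum of squares, hence nonnegative. The largest one therefore bounds
  the moduli of all of them, as the general bound on Hermitian forms demands.\<close>

lemma reduced_density_quadratic_form_le:
  assumes "ordered_eigenvalues d (reduced_density n d c a) l" "d \<ge> 1"
  shows "(\<Sum>g\<in>multi_index d ({1..n} - {a}). (cmod (\<Sum>i = 1..d. cnj (u i) * c (g(a := i))))\<^sup>2)
    \<le> l d * sqnorm {1..d} u"
proof -
  let ?R = "reduced_density n d c a"
  let ?v = "vec d (\<lambda>i. u (Suc i))"
  note iff = ordered_eigenvalues_eigenvalue_iff[OF reduced_density_carrier assms(1)]
  have nonneg: "l i \<ge> 0" if "i \<in> {1..d}" for i
  proof -
    have "eigenvalue ?R (complex_of_real (l i))" using iff that by blast
    then obtain u where "complex_of_real (l i) = complex_of_real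
        (\<Sum>g\<in>multi_index d ({1..n} - {a}). (cmod (\<Sum>i = 1..d. cnj (u i) * c (g(a := i))))\<^sup>2)"
      by (rule reduced_density_eigenvector)
    then show ?thesis by (simp only: of_real_eq_iff) (simp add: sum_nonneg)
  qed
  have le: "l i \<le> l d" if "i \<in> {1..d}" for i
    using assms that by (cases "i = d") (auto simp: ordered_eigenvalues_def)
  have "cmod k \<le> l d" if "eigenvalue ?R k" for k
    using that nonneg le unfolding iff by auto
  moreover have "l d \<ge> 0" using nonneg assms(2) by simp
  ultimately have "cmod (cip {..<d} (($) ?v) (($) (?R *\<^sub>v ?v))) \<le> l d * sqnorm {..<d} (($) ?v)"
    by (intro hermitian_quadratic_form_le hermitian_reduced_density) auto
  also have "sqnorm {..<d} (($) ?v) = sqnorm {1..d} u"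
    unfolding sqnorm_def sum_from_1 by simp
  finally show ?thesis
    unfolding reduced_density_quadratic_form norm_of_real by linarith
qed

lemma sqnorm_site_projs_le_top_eigenvalue:
  assumes n: "n \<ge> 1" and d: "d \<ge> 1"
    and e: "\<And>a. a \<in> {1..n - 1} \<Longrightarrow> sqnorm {1..d} (e a) = 1"
    and l: "ordered_eigenvalues d (reduced_density n d c n) l"
    and pos: "sqnorm (multi_index d {1..n}) (site_projs d e (n - 1) c) > 0"
  shows "sqnorm (multi_index d {1..n}) (site_projs d e (n - 1) c) \<le> l d"
proof -
  let ?M = "multi_index d {1..n}" and ?M' = "multi_index d ({1..n} - {n})"
  let ?x = "site_projs d e (n - 1) c"
  have nn: "n \<in> {1..n}" and M': "{1..n} - {n} = {1..n - 1}" using n by auto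
  obtain y where y: "\<And>f. ?x f = (\<Prod>a = 1..n - 1. e a (f a)) * y f"
    "\<And>f g. (\<And>a. a \<notin> {1..n - 1} \<Longrightarrow> f a = g a) \<Longrightarrow> y f = y g"
    using site_projs_product_form[of d e "n - 1" c] by blast
  define E where "E g = (\<Prod>a = 1..n - 1. e a (g a))" for g :: "nat \<Rightarrow> nat"
  \<comment> \<open>Multi-indices in \<open>?M'\<close> are \<open>undefined\<close> outside
    \<open>{1..n - 1}\<close>, so this function agrees with \<open>g(n := i)\<close> wherever
    \<open>y\<close> can depend on it.\<close>
  define u where "u i = y ((\<lambda>_. undefined)(n := i))" for i
  have x: "?x (g(n := i)) = E g * u i" if "g \<in> ?M'" for g i
  proof -
    have "y (g(n := i)) = u i"
      unfolding u_def by (rule y(2)) (use that in \<open>auto simp: multi_index_def M' PiE_def extensional_def\<close>)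
    moreover have "(\<Prod>a = 1..n - 1. e a ((g(n := i)) a)) = E g"
      unfolding E_def by (intro prod.cong) auto
    ultimately show ?thesis by (simp only: y(1))
  qed
  \<comment> \<open>The squared norm of a product vector is the product of the squared norms of its
    factors, all equal to one.\<close>
  have E1: "sqnorm ?M' E = 1"
  proof -
    have "sqnorm ?M' E = (\<Sum>g\<in>{1..n - 1} \<rightarrow>\<^sub>E {1..d}. \<Prod>a = 1..n - 1. (cmod (e a (g a)))\<^sup>2)"
      unfolding M' by (simp add: sqnorm_def E_def multi_index_def prod_power_distrib flip: prod_norm)
    also have "\<dots> = (\<Prod>a = 1..n - 1. sqnorm {1..d} (e a))"
      unfolding sqnorm_def by (subst prod_sum_PiE) auto
    also have "\<dots> = 1" using e by simp
    finally show ?thesis .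
  qed
  have nx: "sqnorm ?M ?x = sqnorm {1..d} u"
  proof -
    have "sqnorm ?M ?x = (\<Sum>g\<in>?M'. \<Sum>i = 1..d. (cmod (E g * u i))\<^sup>2)"
      unfolding sqnorm_def sum_multi_index_split[OF nn] by (intro sum.cong refl) (simp only: x)
    also have "\<dots> = sqnorm ?M' E * sqnorm {1..d} u"
      by (simp add: sqnorm_def sum_product norm_mult power_mult_distrib)
    finally show ?thesis using E1 by simp
  qed
  let ?h = "\<lambda>g. \<Sum>i = 1..d. cnj (u i) * c (g(n := i))"
  have "cip ?M ?x c = cip ?M' E ?h"
    unfolding cip_def sum_multi_index_split[OF nn]
    by (intro sum.cong refl) (simp only: x, simp add: sum_distrib_left ac_simps)
  moreover have "cip ?M ?x c = complex_of_real (sqnorm ?M ?x)"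
    by (rule cip_site_projs) (use e in auto)
  ultimately have "(sqnorm ?M ?x)\<^sup>2 \<le> sqnorm ?M' ?h"
    using cip_Cauchy_Schwarz[of ?M' E ?h] E1 by simp
  also have "\<dots> \<le> l d * sqnorm {1..d} u"
    using reduced_density_quadratic_form_le[OF l d, of u] by (simp add: sqnorm_def)
  \<comment> \<open>The chain bounds the square of the squared norm by \<open>l d\<close> times that
    squared norm; \<open>pos\<close> permits cancelling one factor.\<close>
  finally show ?thesis
    using pos unfolding nx power2_eq_square by (rule mult_right_le_imp_le)
qed

theorem theorem3:
  fixes n d :: nat
    and c :: "(nat \<Rightarrow> nat) \<Rightarrow> complex"
    and lam :: "nat \<Rightarrow> nat \<Rightarrow> real"
  assumes "n \<ge> 1"
    and "state_norm n d c = 1"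
    and "\<And>a. a \<in> {1..n} \<Longrightarrow> ordered_eigenvalues d (reduced_density n d c a) (lam a)"
  shows "(\<Sum>a = 1..n - 1. \<Sum>i = 1..d - 1. lam a i) \<ge> (\<Sum>i = 1..d - 1. lam n i)"
proof -
  let ?M = "multi_index d {1..n}"
  have c1: "sqnorm ?M c = 1" using assms(2) by (simp add: state_norm_def sqnorm_def)
  \<comment> \<open>For \<open>d = 0\<close> there are no multi-indices on a nonempty set of sites,
    and the state could not have norm one.\<close>
  have d: "d \<ge> 1"
  proof (rule ccontr)
    assume "\<not> d \<ge> 1"
    then have "?M = {}" using assms(1) by (auto simp: multi_index_def PiE_eq_empty_iff)
    then show False using c1 by (simp add: sqnorm_def)
  qed
  \<comment> \<open>Unit trace turns every sum of the lower \<open>d - 1\<close> eigenvalues into a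
    statement about the top one; the goal becomes a lower bound \<open>1 - lam n d\<close>.\<close>
  have top: "(\<Sum>i = 1..d - 1. lam a i) = 1 - lam a d" if a: "a \<in> {1..n}" for a
  proof -
    have "complex_of_real (\<Sum>i = 1..d. lam a i) = complex_of_real 1"
      using ordered_eigenvalues_sum[OF reduced_density_carrier assms(3)[OF a]]
        reduced_density_trace[OF a] c1 by metis
    then have "(\<Sum>i = 1..d. lam a i) = 1" unfolding of_real_eq_iff .
    moreover have "(\<Sum>i = 1..d. lam a i) = (\<Sum>i = 1..d - 1. lam a i) + lam a d"
      using d by (cases d) simp_all
    ultimately show ?thesis by simp
  qed
  have "\<exists>u. sqnorm {1..d} u = 1 \<and> lam a d = sqnorm ?M (site_proj d u a c)" if a: "a \<in> {1..n}" for a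
  proof -
    have "eigenvalue (reduced_density n d c a) (complex_of_real (lam a d))"
      unfolding ordered_eigenvalues_eigenvalue_iff[OF reduced_density_carrier assms(3)[OF a]]
      using d by auto
    then obtain u where u: "sqnorm {1..d} u = 1" "complex_of_real (lam a d) = complex_of_real
        (\<Sum>g\<in>multi_index d ({1..n} - {a}). (cmod (\<Sum>i = 1..d. cnj (u i) * c (g(a := i))))\<^sup>2)"
      by (rule reduced_density_eigenvector)
    then show ?thesis unfolding of_real_eq_iff sqnorm_site_proj[OF a u(1), symmetric] by blast
  qed
  then obtain e where e: "\<And>a. a \<in> {1..n} \<Longrightarrow> sqnorm {1..d} (e a) = 1"
    "\<And>a. a \<in> {1..n} \<Longrightarrow> lam a d = sqnorm ?M (site_proj d (e a) a c)" by metis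
  let ?N = "sqnorm ?M (site_projs d e (n - 1) c)"
  have "1 - ?N \<le> (\<Sum>a = 1..n - 1. sqnorm ?M (\<lambda>f. c f - site_proj d (e a) a c f))"
    unfolding c1[symmetric] by (rule sqnorm_site_projs_ge) (use e(1) in auto)
  also have "\<dots> = (\<Sum>a = 1..n - 1. \<Sum>i = 1..d - 1. lam a i)"
  proof (intro sum.cong refl)
    fix a assume "a \<in> {1..n - 1}"
    then have a: "a \<in> {1..n}" by auto
    show "sqnorm ?M (\<lambda>f. c f - site_proj d (e a) a c f) = (\<Sum>i = 1..d - 1. lam a i)"
      using site_proj_pythagoras[OF a e(1)[OF a], of c] c1 e(2)[OF a] top[OF a] by simp
  qed
  finally have lower: "1 - ?N \<le> (\<Sum>a = 1..n - 1. \<Sum>i = 1..d - 1. lam a i)" .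
  have "?N \<le> lam n d"
  \<comment> \<open>The bound by the top eigenvalue cancels a factor \<open>?N\<close>; otherwise it
    suffices that \<open>lam n d\<close> is itself a squared norm.\<close>
  proof (cases "?N > 0")
    case True
    show ?thesis
      by (rule sqnorm_site_projs_le_top_eigenvalue[OF assms(1) d _ assms(3) True])
        (use e assms(1) in auto)
  next
    case False
    moreover have "lam n d \<ge> 0" using e(2)[of n] assms(1) by simp
    ultimately show ?thesis by linarith
  qed
  then show ?thesis using lower top[of n] assms(1) by simp
qed

end
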